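(* The shift flow $\theta:\mathbb{R}\times\mathcal{U}\to\mathcal{U}$ satisfies the following shadowing property. For every $\varepsilon>0$ there is $\delta>0$ such that for every bi-infinite sequence $(u^i)_{i\in\mathbb{Z}}$ in $\mathcal{U}$ with $d_{\mathcal{U}}(\theta_1u^i,u^{i+1})\le\delta$ for all $i\in\mathbb{Z}$ there exists $u\in\mathcal{U}$ with $d_{\mathcal{U}}(\theta_iu,u^i)\le\varepsilon$ for all $i\in\mathbb{Z}$. If $(u^i)_{i\in\mathbb{Z}}$ is periodic with period $n$ (i.e., $u^{i+n}=u^i$ for all $i$), then so is $u$ (i.e., $\theta_nu=u$).
   Context: $U\subset\mathbb{R}^m$ is compact and convex; $\mathcal{U}$ is the set of all (a.e. equivalence classes of) measurable functions $u:\mathbb{R}\to\mathbb{R}^m$ with $u(t)\in U$ a.e., endowed with the weak$^*$-topology of $L^\infty(\mathbb{R},\mathbb{R}^m)=L^1(\mathbb{R},\mathbb{R}^m)^*$, which makes it compact and metrizable. $d_{\mathcal{U}}$ is a fixed metric on $\mathcal{U}$ compatible with this topology. The shift flow is $\theta_tu=u(\cdot+t)$. *)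

theory Defs
  imports "HOL-Analysis.Analysis"
begin

definition ae_rel :: "((real \<Rightarrow> 'a::euclidean_space) \<times> (real \<Rightarrow> 'a)) set"
  where "ae_rel = {(u, v). u \<in> borel_measurable lebesgue \<and> v \<in> borel_measurable lebesgue
                         \<and> (AE t in lebesgue. u t = v t)}"

definition Linf :: "(real \<Rightarrow> 'a::euclidean_space) set set"
  where "Linf = {u \<in> borel_measurable lebesgue. \<exists>C. AE t in lebesgue. norm (u t) \<le> C} // ae_rel"

text \<open>The integral is constant on almost-everywhere classes (\<open>pairing_class\<close>), so the image is a singleton.\<close>
definition pairing :: "(real \<Rightarrow> 'a::euclidean_space) \<Rightarrow> (real \<Rightarrow> 'a) set \<Rightarrow> real"
  where "pairing x c = the_elem ((\<lambda>u. LINT t|lebesgue. x t \<bullet> u t) ` c)"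

text \<open>The coarsest topology on \<^term>\<open>Linf\<close> for which the pairing with every integrable
  function is continuous.\<close>
definition weak_star :: "(real \<Rightarrow> 'a::euclidean_space) set topology"
  where "weak_star = topology_generated_by
           {{c \<in> Linf. pairing x c \<in> S} | x S. integrable lebesgue x \<and> open S}"

definition controls :: "'a::euclidean_space set \<Rightarrow> (real \<Rightarrow> 'a) set set"
  where "controls U = {u \<in> borel_measurable lebesgue. AE t in lebesgue. u t \<in> U} // ae_rel"

definition control_topology :: "'a::euclidean_space set \<Rightarrow> (real \<Rightarrow> 'a) set topology"
  where "control_topology U = subtopology weak_star (controls U)"

text \<open>The elementwise image of a class under the shift is again a full class,
  see \<open>shift_class\<close> below.\<close>
definition shift :: "real \<Rightarrow> (real \<Rightarrow> 'a) set \<Rightarrow> (real \<Rightarrow> 'a) set"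
  where "shift t c = (\<lambda>u s. u (s + t)) ` c"

lemma equiv_ae_rel:
  "equiv (borel_measurable lebesgue) (ae_rel :: ((real \<Rightarrow> 'a::euclidean_space) \<times> _) set)"
proof (rule equivI)
  show "trans (ae_rel :: ((real \<Rightarrow> 'a) \<times> _) set)"
    unfolding trans_def ae_rel_def by (auto elim: eventually_elim2)
  show "sym (ae_rel :: ((real \<Rightarrow> 'a) \<times> _) set)"
    unfolding sym_def ae_rel_def by (auto elim: eventually_mono)
qed (auto simp: ae_rel_def refl_on_def)

lemma pairing_class:
  fixes u :: "real \<Rightarrow> 'a::euclidean_space"
  assumes u: "u \<in> borel_measurable lebesgue" and x: "integrable lebesgue x"
  shows "pairing x (ae_rel `` {u}) = (LINT t|lebesgue. x t \<bullet> u t)"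
proof -
  have "(LINT t|lebesgue. x t \<bullet> v t) = (LINT t|lebesgue. x t \<bullet> u t)"
    if "(u, v) \<in> ae_rel" for v
  proof (rule integral_cong_AE)
    show "(\<lambda>t. x t \<bullet> v t) \<in> borel_measurable lebesgue"
      using that borel_measurable_integrable[OF x]
      by (intro borel_measurable_inner) (simp_all add: ae_rel_def)
    show "(\<lambda>t. x t \<bullet> u t) \<in> borel_measurable lebesgue"
      using u borel_measurable_integrable[OF x] by (rule borel_measurable_inner[rotated])
    have "AE t in lebesgue. u t = v t"
      using that by (simp add: ae_rel_def)
    then show "AE t in lebesgue. x t \<bullet> v t = x t \<bullet> u t"
      by (rule eventually_mono) simp
  qed
  moreover have "u \<in> ae_rel `` {u}"
    using u by (auto simp: ae_rel_def)
  ultimately have "(\<lambda>v. LINT t|lebesgue. x t \<bullet> v t) ` (ae_rel `` {u}) = {LINT t|lebesgue. x t \<bullet> u t}"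
    by blast
  then show ?thesis
    by (simp add: pairing_def)
qed

lemma shift_measurable_lebesgue: "(\<lambda>s::real. s + t) \<in> lebesgue \<rightarrow>\<^sub>M lebesgue"
  using lebesgue_affine_measurable[of "\<lambda>_. 1" t] by (simp add: add.commute)

lemma AE_lebesgue_shift:
  fixes P :: "real \<Rightarrow> bool"
  assumes "AE s in lebesgue. P s"
  shows "AE s in lebesgue. P (s + t)"
proof -
  obtain N where N: "negligible N" "{s. \<not> P s} \<subseteq> N"
    using assms by (auto simp: eventually_ae_filter_negligible)
  have "{s. \<not> P (s + t)} \<subseteq> (+) (- t) ` N"
    using N(2) by (force simp: image_iff)
  with negligible_translation[OF N(1), of "- t"] show ?thesis
    unfolding eventually_ae_filter_negligible by blast
qed

lemma shift_class:
  fixes u :: "real \<Rightarrow> 'a::euclidean_space"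
  assumes "u \<in> borel_measurable lebesgue"
  shows "shift t (ae_rel `` {u}) = ae_rel `` {\<lambda>s. u (s + t)}"
proof -
  have 1: "(\<lambda>s. v (s + r), \<lambda>s. w (s + r)) \<in> ae_rel" if "(v, w) \<in> ae_rel"
    for v w :: "real \<Rightarrow> 'a" and r
    using that measurable_compose[OF shift_measurable_lebesgue[of r]]
      AE_lebesgue_shift[of "\<lambda>s. v s = w s" r] by (auto simp: ae_rel_def)
  have "v \<in> shift t (ae_rel `` {u})" if "(\<lambda>s. u (s + t), v) \<in> ae_rel" for v
    using 1[OF that, of "- t"] by (auto simp: shift_def image_iff intro!: bexI[of _ "\<lambda>s. v (s - t)"])
  then show ?thesis
    using 1 by (auto simp: shift_def)
qed

lemma shift_controls:
  assumes "c \<in> controls U"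
  shows "shift t c \<in> controls U"
proof -
  obtain u where "u \<in> borel_measurable lebesgue" "AE s in lebesgue. u s \<in> U" "c = ae_rel `` {u}"
    using assms by (auto simp: controls_def elim!: quotientE)
  then show ?thesis
    using measurable_compose[OF shift_measurable_lebesgue[of t], of u borel]
      AE_lebesgue_shift[of "\<lambda>s. u s \<in> U" t]
    by (auto simp: controls_def shift_class intro!: quotientI)
qed

lemma shift_zero: "shift 0 c = c"
  by (simp add: shift_def)

lemma shift_add: "shift s (shift t c) = shift (s + t) c"
  by (simp add: shift_def image_image add.assoc)

lemma topspace_weak_star: "topspace weak_star = Linf"
  unfolding weak_star_def topology_generated_by_topspace
  by (auto intro!: exI[of _ Linf] exI[of _ "\<lambda>_. 0"] exI[of _ UNIV])

lemma controls_subset_Linf: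
  assumes "bounded U"
  shows "controls U \<subseteq> Linf"
proof -
  obtain C where "\<forall>x\<in>U. norm x \<le> C"
    using assms by (auto simp: bounded_iff)
  then have "{u \<in> borel_measurable lebesgue. AE t in lebesgue. u t \<in> U}
      \<subseteq> {u \<in> borel_measurable lebesgue. \<exists>C. AE t in lebesgue. norm (u t) \<le> C}"
    by (fastforce elim: eventually_mono)
  then show ?thesis
    unfolding controls_def Linf_def quotient_def by blast
qed

end

theory Submission
  imports Defs
begin

text \<open>Shadowing is done by gluing: the control equal to \<open>u\<^sup>i(\<sqdot> - i)\<close> on \<open>[i, i + 1)\<close> for every \<open>i\<close>
  shadows the pseudo-orbit, and it is periodic when the pseudo-orbit is. Indeed on \<open>[k, k + 1)\<close> its
  shift by \<open>i\<close> agrees with \<open>\<theta>\<^bsub>-k\<^esub>u\<^bsup>i+k\<^esup>\<close>, which is weak-star close to \<open>u\<^sup>i\<close> because \<open>|k|\<close> applications of the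
  jump estimate connect the two. The estimate is uniform in \<open>i\<close> and the pseudo-orbit since the space
  of controls is weak-star compact: with jumps tending to zero, limits of both sides have the same
  pairing with every integrable function supported in some \<open>[k, k + 1)\<close>, hence coincide.\<close>

section \<open>Weak limits of convexly constrained functions\<close>

lemma integrable_inner_bounded:
  fixes x w :: "'b \<Rightarrow> 'a::euclidean_space"
  assumes x: "integrable M x" and w: "w \<in> borel_measurable M" and C: "AE t in M. norm (w t) \<le> C"
  shows "integrable M (\<lambda>t. x t \<bullet> w t)"
proof (rule Bochner_Integration.integrable_bound)
  show "integrable M (\<lambda>t. C * norm (x t))"
    using x by simp
  show "(\<lambda>t. x t \<bullet> w t) \<in> borel_measurable M"
    using borel_measurable_integrable[OF x] w by simp
  show "AE t in M. norm (x t \<bullet> w t) \<le> norm (C * norm (x t))"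
    using C
  proof eventually_elim
    case (elim t)
    have "\<bar>x t \<bullet> w t\<bar> \<le> norm (w t) * norm (x t)"
      using Cauchy_Schwarz_ineq2[of "x t" "w t"] by (simp add: mult.commute)
    also have "\<dots> \<le> \<bar>C\<bar> * norm (x t)"
      using elim by (intro mult_right_mono) auto
    finally show ?case
      by (simp add: abs_mult)
  qed
qed

text \<open>Tonelli turns the summable integrals into a finite integral of the pointwise series,
  which is therefore finite almost everywhere. This upgrades a geometric rate in mean to convergence
  at almost every point, without extracting a subsequence.\<close>

lemma AE_summable_of_summable_integral:
  fixes f :: "nat \<Rightarrow> 'b \<Rightarrow> real"
  assumes int: "\<And>k. integrable M (f k)" and nonneg: "\<And>k. AE t in M. 0 \<le> f k t"
    and sum: "summable (\<lambda>k. integral\<^sup>L M (f k))"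
  shows "AE t in M. summable (\<lambda>k. f k t)"
proof -
  have pos: "AE t in M. \<forall>k. 0 \<le> f k t"
    using nonneg by (simp add: AE_all_countable)
  have nn: "0 \<le> integral\<^sup>L M (f k)" for k
    by (rule integral_nonneg_AE[OF nonneg])
  have [measurable]: "f k \<in> borel_measurable M" for k
    using int by auto
  have "(\<integral>\<^sup>+ t. (\<Sum>k. ennreal (f k t)) \<partial>M) = (\<Sum>k. \<integral>\<^sup>+ t. ennreal (f k t) \<partial>M)"
    by (rule nn_integral_suminf) simp
  also have "\<dots> = (\<Sum>k. ennreal (integral\<^sup>L M (f k)))"
    by (simp add: nn_integral_eq_integral int nonneg)
  also have "\<dots> = ennreal (\<Sum>k. integral\<^sup>L M (f k))"
    using nn sum by (rule suminf_ennreal2)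
  finally have "(\<integral>\<^sup>+ t. (\<Sum>k. ennreal (f k t)) \<partial>M) \<noteq> \<infinity>"
    by simp
  then have "AE t in M. (\<Sum>k. ennreal (f k t)) \<noteq> \<infinity>"
    by (intro nn_integral_PInf_AE) auto
  with pos show ?thesis
    by eventually_elim (auto intro: summable_suminf_not_top)
qed

text \<open>Partial sums of the increments telescope to \<open>w n - w 0\<close>, and in a Banach
  space absolute summability makes them converge.\<close>

lemma convergent_if_summable_increments:
  fixes w :: "nat \<Rightarrow> 'a::banach"
  assumes "summable (\<lambda>k. norm (w (Suc k) - w k))"
  shows "convergent w"
proof -
  have "summable (\<lambda>k. w (Suc k) - w k)"
    using assms by (rule summable_norm_cancel)
  then obtain s where "(\<lambda>n. \<Sum>k<n. w (Suc k) - w k) \<longlonglongrightarrow> s"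
    by (auto simp: summable_def sums_def)
  then have "(\<lambda>n. w n - w 0) \<longlonglongrightarrow> s"
    by (simp add: sum_lessThan_telescope)
  then have "(\<lambda>n. (w n - w 0) + w 0) \<longlonglongrightarrow> s + w 0"
    by (intro tendsto_add tendsto_const)
  then show ?thesis
    by (auto simp: convergent_def)
qed

text \<open>The sets \<open>K J\<close> of approximate solutions are convex and directed. Minimising a weighted
  \<open>L\<^sup>2\<close> norm along them yields, by the parallelogram law, a sequence that converges almost everywhere
  and whose limit is the same whichever further constraint is imposed.\<close>
lemma weak_limit_exists:
  fixes U :: "'a::euclidean_space set" and L :: "('b \<Rightarrow> 'a) \<Rightarrow> real"
  assumes "sigma_finite_measure M" and "closed U" and "bounded U" and "convex U"
    and approx: "\<And>J \<eta>. finite J \<Longrightarrow> (\<And>x. x \<in> J \<Longrightarrow> integrable M x) \<Longrightarrow> 0 < \<eta> \<Longrightarrow>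
       \<exists>w\<in>borel_measurable M. (AE t in M. w t \<in> U) \<and> (\<forall>x\<in>J. \<bar>(LINT t|M. x t \<bullet> w t) - L x\<bar> < \<eta>)"
  obtains u where "u \<in> borel_measurable M" "AE t in M. u t \<in> U"
    "\<And>x. integrable M x \<Longrightarrow> (LINT t|M. x t \<bullet> u t) = L x"
proof -

  \<comment> \<open>A weighted \<open>L\<^sup>2\<close> functional on bounded functions\<close>
  obtain h where h: "h \<in> borel_measurable M" "integral\<^sup>N M h \<noteq> \<infinity>" 
    "\<And>t. t \<in> space M \<Longrightarrow> 0 < h t \<and> h t < \<infinity>"
    using sigma_finite_measure.Ex_finite_integrable_function[OF assms(1)] by blast
  \<comment> \<open>On an infinite measure space bounded functions may fail to be square integrable.
    A strictly positive integrable weight repairs this and has the same null sets.\<close>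
  define \<rho> where "\<rho> t = enn2real (h t)" for t
  have \<rho>pos: "0 < \<rho> t" if "t \<in> space M" for t
    using h(3)[OF that] by (simp add: \<rho>_def enn2real_positive_iff)
  have \<rho>nn: "0 \<le> \<rho> t" for t
    by (simp add: \<rho>_def)
  have \<rho>[measurable]: "\<rho> \<in> borel_measurable M"
    using h(1) unfolding \<rho>_def by measurable
  have "integral\<^sup>N M h = (\<integral>\<^sup>+ t. ennreal (\<rho> t) \<partial>M)"
    using h(3) by (intro nn_integral_cong) (auto simp: \<rho>_def)
  then have \<rho>int: "integrable M \<rho>"
    using h(2) by (intro integrableI_nonneg) (auto simp: \<rho>nn top.not_eq_extremum)
  define R where "R = integral\<^sup>L M \<rho>"
  obtain C where C: "\<And>y. y \<in> U \<Longrightarrow> norm y \<le> C"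
    using \<open>bounded U\<close> by (auto simp: bounded_iff)
  define V where "V = {w \<in> borel_measurable M. AE t in M. w t \<in> U}"
  define N where "N w = (LINT t|M. \<rho> t * (norm (w t))\<^sup>2)" for w :: "'b \<Rightarrow> 'a"
  have Vm[measurable_dest]: "w \<in> borel_measurable M" if "w \<in> V" for w
    using that by (simp add: V_def)
  have VC: "AE t in M. norm (w t) \<le> C" if "w \<in> V" for w
    using that C unfolding V_def by (auto elim!: eventually_mono)
  have Nint: "integrable M (\<lambda>t. \<rho> t * (norm (w t))\<^sup>2)"
    if [measurable]: "w \<in> borel_measurable M" and b: "AE t in M. norm (w t) \<le> c" for w :: "'b \<Rightarrow> 'a" and c
  proof (rule Bochner_Integration.integrable_bound)
    show "integrable M (\<lambda>t. \<rho> t * c\<^sup>2)"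
      using \<rho>int by simp
    show "AE t in M. norm (\<rho> t * (norm (w t))\<^sup>2) \<le> norm (\<rho> t * c\<^sup>2)"
      using b by eventually_elim (auto simp: \<rho>nn abs_mult intro!: mult_left_mono power_mono)
  qed simp
  have Vint: "integrable M (\<lambda>t. \<rho> t * (norm (w t))\<^sup>2)" if "w \<in> V" for w
    by (rule Nint[OF Vm[OF that] VC[OF that]])
  have Dint: "integrable M (\<lambda>t. \<rho> t * (norm (p t - q t))\<^sup>2)" if "p \<in> V" "q \<in> V" for p q
  proof (rule Nint)
    show "AE t in M. norm (p t - q t) \<le> C + C"
      using VC[OF that(1)] VC[OF that(2)]
      by eventually_elim (metis add_mono norm_triangle_ineq4 order_trans)
  qed (use Vm that in auto)
  have N0: "0 \<le> N w" for w
    unfolding N_def by (intro integral_nonneg_AE) (auto simp: \<rho>nn)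
  have NC: "N w \<le> R * C\<^sup>2" if "w \<in> V" for w
  proof -
    have "N w \<le> (LINT t|M. \<rho> t * C\<^sup>2)"
      unfolding N_def
    proof (rule integral_mono_AE[OF Vint[OF that]])
      show "AE t in M. \<rho> t * (norm (w t))\<^sup>2 \<le> \<rho> t * C\<^sup>2"
        using VC[OF that] by eventually_elim (auto simp: \<rho>nn intro!: mult_left_mono power_mono)
    qed (use \<rho>int in simp)
    then show ?thesis
      by (simp add: R_def)
  qed
  have ipair: "integrable M (\<lambda>t. x t \<bullet> w t)" if "integrable M x" "w \<in> V" for x w
    by (rule integrable_inner_bounded[OF that(1) Vm[OF that(2)] VC[OF that(2)]])
  define mid where "mid p q = (\<lambda>t. (1/2) *\<^sub>R p t + (1/2) *\<^sub>R q t)" for p q :: "'b \<Rightarrow> 'a"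
  have midV: "mid p q \<in> V" if "p \<in> V" "q \<in> V" for p q
  proof -
    have "AE t in M. mid p q t \<in> U"
      using that[unfolded V_def] 
    proof (elim CollectE conjE)
      assume "AE t in M. p t \<in> U" "AE t in M. q t \<in> U"
      then show ?thesis
        by eventually_elim (auto simp: mid_def intro: convexD[OF \<open>convex U\<close>])
    qed
    then show ?thesis
      using that by (auto simp: V_def mid_def)
  qed
  \<comment> \<open>The parallelogram law, integrated against the weight.\<close>
  have par: "N (\<lambda>t. p t - q t) = 2 * N p + 2 * N q - 4 * N (mid p q)" if "p \<in> V" "q \<in> V" for p q
  proof -
    have "N (\<lambda>t. p t - q t) = (LINT t|M. 2 * (\<rho> t * (norm (p t))\<^sup>2) + 2 * (\<rho> t * (norm (q t))\<^sup>2)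
        - 4 * (\<rho> t * (norm (mid p q t))\<^sup>2))"
      unfolding N_def
      by (rule Bochner_Integration.integral_cong)
        (simp_all add: mid_def power2_norm_eq_inner algebra_simps inner_commute)
    also have "\<dots> = 2 * N p + 2 * N q - 4 * N (mid p q)"
      using Vint[OF that(1)] Vint[OF that(2)] Vint[OF midV[OF that]] by (simp add: N_def)
    finally show ?thesis .
  qed

  \<comment> \<open>Sets of approximate solutions\<close>
  define K where "K J = {w \<in> V. \<forall>(x, \<eta>)\<in>J. \<bar>(LINT t|M. x t \<bullet> w t) - L x\<bar> < \<eta>}"
    for J :: "(('b \<Rightarrow> 'a) \<times> real) set"
  define good where "good J \<longleftrightarrow> finite J \<and> (\<forall>(x, \<eta>)\<in>J. integrable M x \<and> 0 < \<eta>)"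
    for J :: "(('b \<Rightarrow> 'a) \<times> real) set"
  have KV: "w \<in> V" if "w \<in> K J" for w J
    using that by (simp add: K_def)
  \<comment> \<open>Each test function carries its own tolerance, so combining two systems of
    constraints is a union of index sets and an intersection of solution sets.\<close>
  have K_Un: "K (I \<union> J) = K I \<inter> K J" for I J
    by (auto simp: K_def)
  have Kne: "K J \<noteq> {}" if "good J" for J
  proof -
    \<comment> \<open>\<open>approx\<close> takes a single tolerance, so the smallest one in
      \<open>J\<close> is used; the entry 1 keeps the minimum meaningful for empty
      \<open>J\<close>.\<close>
    define \<eta> where "\<eta> = Min (insert 1 (snd ` J))"
    have fin: "finite J" and J: "\<And>x \<eta>. (x, \<eta>) \<in> J \<Longrightarrow> integrable M x \<and> 0 < \<eta>"
      using that by (auto simp: good_def)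
    have "0 < \<eta>" 
      using fin J by (auto simp: \<eta>_def)
    then obtain w where w: "w \<in> borel_measurable M" "AE t in M. w t \<in> U"
      "\<forall>x\<in>fst ` J. \<bar>(LINT t|M. x t \<bullet> w t) - L x\<bar> < \<eta>"
      using approx[of "fst ` J" \<eta>] fin J by fastforce
    have "\<bar>(LINT t|M. x t \<bullet> w t) - L x\<bar> < e" if "(x, e) \<in> J" for x e
    proof -
      have "\<eta> \<le> e"
        unfolding \<eta>_def using fin that by (intro Min_le) force+
      moreover have "\<bar>(LINT t|M. x t \<bullet> w t) - L x\<bar> < \<eta>"
        using w(3) that by force
      ultimately show ?thesis
        by linarith
    qed
    then have "w \<in> K J"
      using w by (auto simp: K_def V_def)
    then show ?thesis
      by blast
  qed
  have midK: "mid p q \<in> K J" if "p \<in> K J" "q \<in> K J" "good J" for p q J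
  proof -
    have "\<bar>(LINT t|M. x t \<bullet> mid p q t) - L x\<bar> < e" if xe: "(x, e) \<in> J" for x e
    proof -
      have "integrable M x"
        using xe \<open>good J\<close> by (auto simp: good_def)
      note i = ipair[OF this KV[OF \<open>p \<in> K J\<close>]] ipair[OF this KV[OF \<open>q \<in> K J\<close>]]
      have "(LINT t|M. x t \<bullet> mid p q t) = (1/2) * (LINT t|M. x t \<bullet> p t) + (1/2) * (LINT t|M. x t \<bullet> q t)"
        using i by (simp add: mid_def inner_add_right)
      moreover have "\<bar>(LINT t|M. x t \<bullet> p t) - L x\<bar> < e" "\<bar>(LINT t|M. x t \<bullet> q t) - L x\<bar> < e"
        using xe \<open>p \<in> K J\<close> \<open>q \<in> K J\<close> by (auto simp: K_def)
      ultimately show ?thesis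
        by linarith
    qed
    moreover have "mid p q \<in> V"
      using that(1,2) by (intro midV KV)
    ultimately show ?thesis
      by (auto simp: K_def)
  qed

  \<comment> \<open>Near-minimisers of the functional\<close>
  define \<alpha> where "\<alpha> J = Inf (N ` K J)" for J
  define S where "S = Sup (\<alpha> ` Collect good)"
  have bdd: "bdd_below (N ` K J)" for J
    using N0 by (auto intro!: bdd_belowI)
  have \<alpha>le: "\<alpha> J \<le> N w" if "w \<in> K J" for J w
    unfolding \<alpha>_def using bdd that by (auto intro: cInf_lower)
  have \<alpha>S: "\<alpha> J \<le> S" if "good J" for J
    unfolding S_def
  proof (rule cSup_upper)
    show "bdd_above (\<alpha> ` Collect good)"
    proof (intro bdd_aboveI2)
      fix J assume "J \<in> Collect good"
      then obtain w where "w \<in> K J" 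
        using Kne by blast
      with \<alpha>le NC KV show "\<alpha> J \<le> R * C\<^sup>2"
        by (meson order_trans)
    qed
  qed (use that in auto)
  \<comment> \<open>The rate is chosen for later: passing from squares to the increments themselves
    costs a factor \<open>2^k\<close>, and \<open>2^k * (1/4)^k\<close> is still summable.\<close>
  have "\<exists>J. good J \<and> S - (1/4)^k < \<alpha> J" for k :: nat
  proof -
    have "good {}"
      by (simp add: good_def)
    then have "\<exists>a\<in>\<alpha> ` Collect good. S - (1/4)^k < a"
      by (intro less_cSupD) (auto simp flip: S_def)
    then show ?thesis
      by auto
  qed
  then obtain J where J: "\<And>k. good (J k)" "\<And>k. S - (1/4)^k < \<alpha> (J k)"
    by metis
  \<comment> \<open>Accumulating the constraints makes the sets \<open>K (A k)\<close> decrease,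
    while each stays inside \<open>K (J k)\<close>, where \<open>N\<close> exceeds
    \<open>S - (1/4)^k\<close>.\<close>
  define A where "A k = (\<Union>i\<le>k. J i)" for k
  have Agood: "good (A k)" for k
    using J(1) by (auto simp: A_def good_def)
  have good_Un: "good (I \<union> J)" if "good I" "good J" for I J
    using that by (auto simp: good_def)
  have KA: "K (A k) \<subseteq> K (J k)" "K (A (Suc k)) \<subseteq> K (A k)" for k
    by (auto simp: K_def A_def)
  define G where "G k = {w \<in> K (A k). N w < S + (1/4)^k}" for k
  have GV: "w \<in> V" if "w \<in> G k" for w k
    using that KV by (auto simp: G_def)
  \<comment> \<open>Since \<open>\<alpha>\<close> never exceeds \<open>S\<close> on good index sets,
    a near-minimiser survives any further good constraint \<open>B\<close>. This freedom later
    identifies the limit.\<close>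
  have Gex: "\<exists>w. w \<in> G k \<and> w \<in> K B" if "good B" for k B
  proof -
    have g: "good (A k \<union> B)"
      using Agood that by (rule good_Un)
    then have "\<alpha> (A k \<union> B) < S + (1/4)^k"
      using \<alpha>S[OF g] by (smt (verit) zero_less_power zero_less_divide_1_iff zero_less_numeral)
    then obtain w where "w \<in> K (A k \<union> B)" "N w < S + (1/4)^k"
      unfolding \<alpha>_def using cInf_lessD[of "N ` K (A k \<union> B)"] Kne[OF g] by fast
    then show ?thesis
      by (auto simp: G_def K_Un)
  qed
  \<comment> \<open>The midpoint stays in the convex set \<open>K (A k)\<close>, so its
    \<open>N\<close> exceeds \<open>S - (1/4)^k\<close>, while \<open>N p\<close> and
    \<open>N q\<close> are below \<open>S + (1/4)^k\<close>. In the parallelogram law the terms in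
    \<open>S\<close> cancel and eight times \<open>(1/4)^k\<close> remains.\<close>
  have Gdiam: "N (\<lambda>t. p t - q t) \<le> 8 * (1/4)^k" if "p \<in> G k" "q \<in> G k" for p q k
  proof -
    have "mid p q \<in> K (A k)"
      using midK[OF _ _ Agood] that by (simp add: G_def)
    then have "S - (1/4)^k < N (mid p q)"
      using \<alpha>le J(2)[of k] KA(1)[of k] by (meson less_le_trans subsetD)
    then show ?thesis
      using par[OF GV[OF that(1)] GV[OF that(2)]] that by (simp add: G_def)
  qed
  have GSuc: "G (Suc k) \<subseteq> G k" for k
  proof -
    have "(1/4::real)^Suc k \<le> (1/4)^k"
      by simp
    then show ?thesis
      using KA(2)[of k] less_le_trans[of _ "S + (1/4)^Suc k" "S + (1/4)^k"] unfolding G_def by fastforce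
  qed

  \<comment> \<open>An almost everywhere convergent minimising sequence\<close>
  have "\<exists>w. \<forall>k. w k \<in> G k"
    using Gex[of "{}"] by (simp add: good_def) metis
  then obtain w where w: "\<And>k. w k \<in> G k"
    by blast
  have wV: "w k \<in> V" for k
    using GV w by blast
  have [measurable]: "w k \<in> borel_measurable M" for k
    using wV Vm by blast
  have "AE t in M. summable (\<lambda>k. \<rho> t * norm (w (Suc k) t - w k t))"
  proof (rule AE_summable_of_summable_integral)
    \<comment> \<open>For the norm \<open>a\<close> of an increment,
      \<open>a \<le> (1/2)^k + 2^k * a\<^sup>2\<close>: either the first term dominates or
      \<open>1 \<le> 2^k * a\<close>. Integrated against the weight, this turns the bound on squares
      from \<open>Gdiam\<close> into \<open>(R + 8) * (1/2)^k\<close> for the increments.\<close>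
    define g where "g k t = \<rho> t * (1/2)^k + 2^k * (\<rho> t * (norm (w (Suc k) t - w k t))\<^sup>2)" for k t
    have gi: "integrable M (g k)" for k
      unfolding g_def using \<rho>int Dint[OF wV wV, of "Suc k" k] by simp
    have le: "\<rho> t * norm (w (Suc k) t - w k t) \<le> g k t" for k t
    proof -
      define a where "a = norm (w (Suc k) t - w k t)"
      have "a \<le> (1/2)^k + 2^k * a\<^sup>2"
      proof (cases "a \<le> (1/2)^k")
        case False
        then have "1 \<le> 2^k * a"
          by (simp add: field_simps power_one_over)
        then have "a * 1 \<le> a * (2^k * a)"
          by (intro mult_left_mono) (auto simp: a_def)
        then show ?thesis
          by (simp add: power2_eq_square mult_ac add_increasing)
      qed (simp add: add_increasing2)
      then have "\<rho> t * a \<le> \<rho> t * ((1/2)^k + 2^k * a\<^sup>2)"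
        by (intro mult_left_mono) (auto simp: \<rho>nn)
      then show ?thesis
        by (simp add: g_def a_def algebra_simps)
    qed
    show fi: "integrable M (\<lambda>t. \<rho> t * norm (w (Suc k) t - w k t))" for k
      by (rule Bochner_Integration.integrable_bound[OF gi[of k]])
        (use le \<rho>nn in \<open>auto simp: abs_mult intro: order_trans[OF _ abs_ge_self]\<close>)
    show "AE t in M. 0 \<le> \<rho> t * norm (w (Suc k) t - w k t)" for k
      by (simp add: \<rho>nn)
    have b: "(LINT t|M. \<rho> t * norm (w (Suc k) t - w k t)) \<le> (R + 8) * (1/2)^k" for k
    proof -
      have "(LINT t|M. \<rho> t * norm (w (Suc k) t - w k t)) \<le> integral\<^sup>L M (g k)"
        by (intro integral_mono fi gi le)
      also have "\<dots> = R * (1/2)^k + 2^k * N (\<lambda>t. w (Suc k) t - w k t)"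
        unfolding g_def N_def R_def using \<rho>int Dint[OF wV wV, of "Suc k" k] by simp
      also have "N (\<lambda>t. w (Suc k) t - w k t) \<le> 8 * (1/4)^k"
        using w GSuc by (intro Gdiam) blast+
      also have "R * (1/2)^k + 2^k * (8 * (1/4)^k) = (R + 8) * (1/2)^k"
        by (simp add: algebra_simps flip: power_mult_distrib)
      finally show ?thesis
        by simp
    qed
    show "summable (\<lambda>k. LINT t|M. \<rho> t * norm (w (Suc k) t - w k t))"
    proof (rule summable_comparison_test'[where N = 0])
      show "summable (\<lambda>k. (R + 8) * (1/2::real)^k)"
        by (intro summable_mult summable_geometric) simp
      show "norm (LINT t|M. \<rho> t * norm (w (Suc k) t - w k t)) \<le> (R + 8) * (1/2)^k" for k
        using b[of k] by (simp add: \<rho>nn)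
    qed
  qed
  then have "AE t in M. convergent (\<lambda>k. w k t)"
    using AE_space
  proof eventually_elim
    case (elim t)
    then show ?case
      using \<rho>pos[of t] by (intro convergent_if_summable_increments) (simp add: summable_cmult_iff)
  qed
  define u where "u t = lim (\<lambda>k. w k t)" for t
  have u[measurable]: "u \<in> borel_measurable M"
    unfolding u_def by measurable
  have wu: "AE t in M. (\<lambda>k. w k t) \<longlonglongrightarrow> u t"
    using \<open>AE t in M. convergent _\<close> by (simp add: u_def convergent_LIMSEQ_iff)
  have "AE t in M. \<forall>k. w k t \<in> U"
    using wV by (simp add: AE_all_countable V_def)
  with wu have uU: "AE t in M. u t \<in> U"
    by eventually_elim (use \<open>closed U\<close> in \<open>auto intro: closed_sequentially\<close>)

  \<comment> \<open>The limit satisfies every constraint\<close>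
  have "\<bar>(LINT t|M. x t \<bullet> u t) - L x\<bar> \<le> \<eta>" if x: "integrable M x" and "0 < \<eta>" for x \<eta>
  proof -
    have "good {(x, \<eta>)}"
      using that by (simp add: good_def)
    \<comment> \<open>The limit \<open>u\<close> was fixed before \<open>x\<close>. Near-minimisers
      \<open>z k\<close> that also meet the constraint at \<open>x\<close> differ from
      \<open>w k\<close> by at most the diameter bound of \<open>G k\<close>, so they have the same
      limit almost everywhere. Dominated convergence then carries the constraint over to
      \<open>u\<close>, with a non-strict bound.\<close>
    from Gex[OF this] obtain z where z: "\<And>k. z k \<in> G k" "\<And>k. z k \<in> K {(x, \<eta>)}"
      by metis
    have zV: "z k \<in> V" for k
      using GV z(1) by blast
    have [measurable]: "z k \<in> borel_measurable M" for k
      using zV Vm by blast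
    have "AE t in M. summable (\<lambda>k. \<rho> t * (norm (z k t - w k t))\<^sup>2)"
    proof (rule AE_summable_of_summable_integral)
      show "summable (\<lambda>k. LINT t|M. \<rho> t * (norm (z k t - w k t))\<^sup>2)"
      proof (rule summable_comparison_test'[where N = 0])
        show "summable (\<lambda>k. 8 * (1/4::real)^k)"
          by (intro summable_mult summable_geometric) simp
        show "norm (LINT t|M. \<rho> t * (norm (z k t - w k t))\<^sup>2) \<le> 8 * (1/4)^k" for k
          using Gdiam[OF z(1) w, of k] N0[of "\<lambda>t. z k t - w k t"] by (simp add: N_def)
      qed
    qed (auto simp: \<rho>nn intro!: Dint zV wV)
    with wu have zu: "AE t in M. (\<lambda>k. z k t) \<longlonglongrightarrow> u t"
      using AE_space
    proof eventually_elim
      case (elim t)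
      then have "summable (\<lambda>k. (norm (z k t - w k t))\<^sup>2)"
        using \<rho>pos[of t] by (simp add: summable_cmult_iff)
      then have "(\<lambda>k. sqrt ((norm (z k t - w k t))\<^sup>2)) \<longlonglongrightarrow> sqrt 0"
        by (intro tendsto_real_sqrt summable_LIMSEQ_zero)
      then have "(\<lambda>k. z k t - w k t) \<longlonglongrightarrow> 0"
        by (simp add: tendsto_norm_zero_iff)
      then show ?case
        using tendsto_add[OF _ elim(1)] by fastforce
    qed
    have "(\<lambda>k. LINT t|M. x t \<bullet> z k t) \<longlonglongrightarrow> (LINT t|M. x t \<bullet> u t)"
    proof (rule integral_dominated_convergence[where w = "\<lambda>t. norm (x t) * C"])
      show "AE t in M. (\<lambda>k. x t \<bullet> z k t) \<longlonglongrightarrow> x t \<bullet> u t"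
        using zu by eventually_elim (intro tendsto_intros)
      show "AE t in M. norm (x t \<bullet> z k t) \<le> norm (x t) * C" for k
        using VC[OF zV[of k]]
        by eventually_elim
          (simp, rule order_trans[OF Cauchy_Schwarz_ineq2], simp add: mult_left_mono)
    qed (use borel_measurable_integrable[OF x] x in auto)
    then have "(\<lambda>k. \<bar>(LINT t|M. x t \<bullet> z k t) - L x\<bar>) \<longlonglongrightarrow> \<bar>(LINT t|M. x t \<bullet> u t) - L x\<bar>"
      by (intro tendsto_intros)
    moreover have "\<bar>(LINT t|M. x t \<bullet> z k t) - L x\<bar> \<le> \<eta>" for k
      using z(2)[of k] by (simp add: K_def)
    ultimately show ?thesis
      using LIMSEQ_le_const2 by blast
  qed
  then have "(LINT t|M. x t \<bullet> u t) = L x" if "integrable M x" for x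
    using that field_le_epsilon[of "\<bar>(LINT t|M. x t \<bullet> u t) - L x\<bar>" 0] by auto
  with u uU show ?thesis
    using that by blast
qed

section \<open>Compactness of the space of controls\<close>

text \<open>Completion preserves the measure of Borel sets, so a countable cover for
  \<open>lborel\<close> serves here too.\<close>

lemma sigma_finite_lebesgue: "sigma_finite_measure lebesgue"
proof
  obtain A :: "'a set set" where A: "countable A" "A \<subseteq> sets lborel" "\<Union>A = space lborel"
      "\<forall>a\<in>A. emeasure lborel a \<noteq> \<infinity>"
    using lborel.sigma_finite_countable by blast
  then have "emeasure lebesgue a \<noteq> \<infinity>" if "a \<in> A" for a
    using that by (auto simp: subset_iff)
  with A show "\<exists>A::'a set set. countable A \<and> A \<subseteq> sets lebesgue \<and> \<Union>A = space lebesgue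
      \<and> (\<forall>a\<in>A. emeasure lebesgue a \<noteq> \<infinity>)"
    by (intro exI[of _ A]) (auto intro: sets_completionI_sets)
qed

lemma controls_cases:
  assumes "c \<in> controls U"
  obtains u where "u \<in> borel_measurable lebesgue" "AE t in lebesgue. u t \<in> U" "c = ae_rel `` {u}"
  using assms by (auto simp: controls_def elim!: quotientE)

lemma controlsI:
  assumes "u \<in> borel_measurable lebesgue" "AE t in lebesgue. u t \<in> U"
  shows "ae_rel `` {u} \<in> controls U"
  using assms by (auto simp: controls_def intro: quotientI)

lemma ae_rel_class_eqI:
  assumes "u \<in> borel_measurable lebesgue" "v \<in> borel_measurable lebesgue" "AE t in lebesgue. u t = v t"
  shows "ae_rel `` {u} = ae_rel `` {v}"
  using equiv_class_eq[OF equiv_ae_rel] assms by (auto simp: ae_rel_def)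

lemma continuous_map_pairing:
  assumes "integrable lebesgue x"
  shows "continuous_map weak_star euclideanreal (pairing x)"
  unfolding continuous_map_def topspace_weak_star
  using assms by (auto simp: weak_star_def intro!: topology_generated_by_Basis)

text \<open>Induction over the generation of the topology: intersections merge the finite sets of
  test functions and take the smaller tolerance, unions keep the data of one member, and a generator
  contributes a ball around the value of its pairing.\<close>

lemma weak_star_nbhd:
  assumes "openin weak_star W" "c \<in> W"
  shows "\<exists>J \<eta>. finite J \<and> (\<forall>x\<in>J. integrable lebesgue x) \<and> 0 < \<eta> \<and>
    (\<forall>b\<in>Linf. (\<forall>x\<in>J. \<bar>pairing x b - pairing x c\<bar> < \<eta>) \<longrightarrow> b \<in> W)"
proof -
  have "generate_topology_on {{c \<in> Linf. pairing x c \<in> S} | x S. integrable lebesgue x \<and> open S} W"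
    using assms(1) unfolding weak_star_def by (rule openin_topology_generated_by)
  then show ?thesis
    using assms(2)
  proof (induction rule: generate_topology_on.induct)
    case (Int V W)
    from Int.IH(1) Int.prems obtain I \<eta> where I: "finite I" "\<forall>x\<in>I. integrable lebesgue x" "0 < \<eta>"
      "\<forall>b\<in>Linf. (\<forall>x\<in>I. \<bar>pairing x b - pairing x c\<bar> < \<eta>) \<longrightarrow> b \<in> V"
      by blast
    from Int.IH(2) Int.prems obtain J \<zeta> where J: "finite J" "\<forall>x\<in>J. integrable lebesgue x" "0 < \<zeta>"
      "\<forall>b\<in>Linf. (\<forall>x\<in>J. \<bar>pairing x b - pairing x c\<bar> < \<zeta>) \<longrightarrow> b \<in> W"
      by blast
    from I J show ?case
      by (intro exI[of _ "I \<union> J"] exI[of _ "min \<eta> \<zeta>"]) auto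
  next
    case (UN \<K>)
    then obtain V where "V \<in> \<K>" "c \<in> V"
      by blast
    with UN.IH[OF this] show ?case
      by (meson UnionI)
  next
    case (Basis V)
    then obtain x S where V: "V = {c \<in> Linf. pairing x c \<in> S}" "integrable lebesgue x" "open S"
      by blast
    with Basis obtain \<eta> where "0 < \<eta>" "ball (pairing x c) \<eta> \<subseteq> S"
      by (auto simp: open_contains_ball)
    with V show ?case
      by (intro exI[of _ "{x}"] exI[of _ \<eta>]) (auto simp: dist_real_def abs_minus_commute subset_iff)
  qed simp
qed

text \<open>A cluster point of the pairings exists by Tychonoff's theorem, and \<open>weak_limit_exists\<close> represents
  it by a control.\<close>
lemma controls_cluster_point:
  fixes U :: "'a::euclidean_space set" and f :: "nat \<Rightarrow> (real \<Rightarrow> 'a) set"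
  assumes "closed U" "bounded U" "convex U" and f: "\<And>n. f n \<in> controls U"
  shows "\<exists>c\<in>controls U. \<forall>J \<eta>. finite J \<longrightarrow> (\<forall>x\<in>J. integrable lebesgue x) \<longrightarrow> 0 < \<eta> \<longrightarrow>
    (\<exists>\<^sub>F n in sequentially. \<forall>x\<in>J. \<bar>pairing x (f n) - pairing x c\<bar> < \<eta>)"
proof -
  have "\<exists>u. u \<in> borel_measurable lebesgue \<and> (AE t in lebesgue. u t \<in> U) \<and> f n = ae_rel `` {u}" for n
    using controls_cases[OF f] by metis
  then obtain w where w: "\<And>n. w n \<in> borel_measurable lebesgue" "\<And>n. AE t in lebesgue. w n t \<in> U"
    "\<And>n. f n = ae_rel `` {w n}"
    by metis
  obtain C where C: "\<And>y. y \<in> U \<Longrightarrow> norm y \<le> C"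
    using \<open>bounded U\<close> by (auto simp: bounded_iff)
  have wC: "AE t in lebesgue. norm (w n t) \<le> C" for n
    using w(2)[of n] C by (auto elim: eventually_mono)
  \<comment> \<open>The default 0 for non-integrable \<open>x\<close> lets the product range over
    all functions \<open>x\<close>. The absolute value in \<open>B\<close> keeps the interval around
    0 nonempty, so that it contains this default.\<close>
  define g :: "nat \<Rightarrow> (real \<Rightarrow> 'a) \<Rightarrow> real"
    where "g n x = (if integrable lebesgue x then LINT t|lebesgue. x t \<bullet> w n t else 0)" for n x
  define B where "B x = (LINT t|lebesgue. norm (x t) * \<bar>C\<bar>)" for x :: "real \<Rightarrow> 'a"
  have gB: "g n x \<in> {- B x..B x}" for n x
  proof (cases "integrable lebesgue x")
    case True
    have "\<bar>LINT t|lebesgue. x t \<bullet> w n t\<bar> \<le> (LINT t|lebesgue. norm (x t \<bullet> w n t))"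
      using integral_norm_bound[of lebesgue "\<lambda>t. x t \<bullet> w n t"] by simp
    also have "\<dots> \<le> B x"
      unfolding B_def
    proof (rule integral_mono_AE)
      show "integrable lebesgue (\<lambda>t. norm (x t \<bullet> w n t))"
        using integrable_inner_bounded[OF True w(1) wC] by (rule integrable_norm)
      show "AE t in lebesgue. norm (x t \<bullet> w n t) \<le> norm (x t) * \<bar>C\<bar>"
        using wC[of n]
        by eventually_elim
          (simp, rule order_trans[OF Cauchy_Schwarz_ineq2], simp add: mult_left_mono)
    qed (use True in simp)
    finally show ?thesis
      using True by (simp add: g_def abs_le_iff)
  next
    case False
    have "0 \<le> B x"
      unfolding B_def by (rule integral_nonneg_AE) simp
    with False show ?thesis
      by (simp add: g_def)
  qed
  have "compact (PiE UNIV (\<lambda>x. {- B x..B x}))"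
    using compactin_PiE[of "\<lambda>_. euclideanreal" UNIV "\<lambda>x. {- B x..B x}"]
    by (simp add: euclidean_product_topology)
  \<comment> \<open>The product has uncountably many factors, so compactness is used through
    filters: \<open>L\<close> is a cluster point, and no convergent subsequence is claimed.\<close>
  then obtain L where L: "inf (nhds L) (filtermap g sequentially) \<noteq> bot"
    unfolding compact_filter using gB
    by (metis (no_types, lifting) PiE_UNIV_domain UNIV_I Pi_I eventuallyI eventually_filtermap
        filtermap_bot_iff trivial_limit_sequentially)
  have freq: "\<exists>\<^sub>F n in sequentially. \<forall>x\<in>J. \<bar>g n x - L x\<bar> < \<eta>" if "finite J" "0 < \<eta>" for J \<eta>
  proof (rule ccontr)
    \<comment> \<open>\<open>W\<close> restricts finitely many coordinates only, hence is open in
      the product topology.\<close>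
    define W where "W = (\<Inter>x\<in>J. {h. \<bar>h x - L x\<bar> < \<eta>})"
    have "open W"
      unfolding W_def using \<open>finite J\<close>
      by (intro open_INT ballI open_Collect_less continuous_intros) auto
    moreover have "L \<in> W"
      using \<open>0 < \<eta>\<close> by (simp add: W_def)
    ultimately have "eventually (\<lambda>h. h \<in> W) (nhds L)"
      by (auto simp: eventually_nhds)
    moreover assume "\<not> (\<exists>\<^sub>F n in sequentially. \<forall>x\<in>J. \<bar>g n x - L x\<bar> < \<eta>)"
    then have "eventually (\<lambda>h. h \<notin> W) (filtermap g sequentially)"
      by (simp add: not_frequently eventually_filtermap W_def)
    ultimately have "eventually (\<lambda>_. False) (inf (nhds L) (filtermap g sequentially))"
      unfolding eventually_inf by blast
    with L show False
      by (simp add: eventually_False)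
  qed
  \<comment> \<open>A suitable \<open>w n\<close> from the sequence itself is an approximate
    solution, which is what \<open>weak_limit_exists\<close> asks for.\<close>
  have "\<exists>v\<in>borel_measurable lebesgue. (AE t in lebesgue. v t \<in> U) \<and>
      (\<forall>x\<in>J. \<bar>(LINT t|lebesgue. x t \<bullet> v t) - L x\<bar> < \<eta>)"
    if J: "finite J" "\<And>x. x \<in> J \<Longrightarrow> integrable lebesgue x" "0 < \<eta>" for J \<eta>
  proof -
    obtain n where n: "\<forall>x\<in>J. \<bar>g n x - L x\<bar> < \<eta>"
      using frequently_ex[OF freq[OF J(1,3)]] by blast
    show ?thesis
      using n J(2) w by (intro bexI[of _ "w n"]) (auto simp: g_def)
  qed
  from weak_limit_exists[OF sigma_finite_lebesgue assms(1-3) this]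
  obtain v where v: "v \<in> borel_measurable lebesgue" "AE t in lebesgue. v t \<in> U"
      "\<And>x. integrable lebesgue x \<Longrightarrow> (LINT t|lebesgue. x t \<bullet> v t) = L x"
    by blast
  show ?thesis
  proof (intro bexI[of _ "ae_rel `` {v}"] allI impI)
    show "ae_rel `` {v} \<in> controls U"
      using v by (intro controlsI)
  next
    fix J :: "(real \<Rightarrow> 'a) set" and \<eta> :: real
    assume J: "finite J" "\<forall>x\<in>J. integrable lebesgue x" "0 < \<eta>"
    have "pairing x (f n) = g n x" "pairing x (ae_rel `` {v}) = L x" if "x \<in> J" for n x
      using J(2) that v w by (simp_all add: pairing_class g_def)
    with freq[OF J(1,3)]
    show "\<exists>\<^sub>F n in sequentially. \<forall>x\<in>J. \<bar>pairing x (f n) - pairing x (ae_rel `` {v})\<bar> < \<eta>"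
      by (auto elim: frequently_elim1)
  qed
qed

text \<open>Each property holds at arbitrarily large indices, so the next index can always be taken
  beyond the previous one.\<close>

lemma strict_mono_choice:
  assumes "\<And>k. \<exists>\<^sub>F n in sequentially. P k n"
  shows "\<exists>r::nat \<Rightarrow> nat. strict_mono r \<and> (\<forall>k. P k (r k))"
proof -
  have "\<exists>r. \<forall>k. P k (r k) \<and> r k < r (Suc k)"
  proof (rule dependent_nat_choice)
    show "\<exists>n. P 0 n"
      using frequently_ex[OF assms] .
    show "\<exists>m. P (Suc k) m \<and> n < m" for n k
      using assms[of "Suc k"] unfolding frequently_sequentially by (metis Suc_le_eq)
  qed
  then show ?thesis
    by (auto simp: strict_mono_Suc_iff)
qed

text \<open>Metrisability reduces compactness to sequential compactness. The sequence enters every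
  metric ball around its weak-star cluster point frequently, and shrinking balls then give a
  convergent subsequence.\<close>

lemma compact_space_controls:
  fixes U :: "'a::euclidean_space set"
  assumes "compact U" "convex U" and "Metric_space (controls U) d"
    and top: "Metric_space.mtopology (controls U) d = control_topology U"
  shows "compact_space (control_topology U)"
proof -
  interpret Metric_space "controls U" d
    by fact
  note U = compact_imp_closed[OF \<open>compact U\<close>] compact_imp_bounded[OF \<open>compact U\<close>]
  have "\<exists>c r. c \<in> controls U \<and> strict_mono r \<and> limitin mtopology (f \<circ> r) c sequentially"
    if f: "range f \<subseteq> controls U" for f :: "nat \<Rightarrow> _"
  proof -
    have fc: "f n \<in> controls U" for n
      using f by blast
    from controls_cluster_point[where f = f, OF U \<open>convex U\<close> fc]
    obtain c where c: "c \<in> controls U" and cluster: "\<And>J \<eta>. finite J \<Longrightarrow>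
        \<forall>x\<in>J. integrable lebesgue x \<Longrightarrow> 0 < \<eta> \<Longrightarrow>
        \<exists>\<^sub>F n in sequentially. \<forall>x\<in>J. \<bar>pairing x (f n) - pairing x c\<bar> < \<eta>"
      by blast
    have "\<exists>\<^sub>F n in sequentially. d (f n) c < inverse (real (Suc k))" for k
    proof -
      \<comment> \<open>Being open, the metric ball contains all controls that are close to
        \<open>c\<close> on finitely many test functions; this links \<open>d\<close> to the
        pairings.\<close>
      have "openin (control_topology U) (mball c (inverse (real (Suc k))))"
        using openin_mball by (simp add: top)
      then obtain W where W: "openin weak_star W" "mball c (inverse (real (Suc k))) = W \<inter> controls U"
        by (auto simp: control_topology_def openin_subtopology)
      have "c \<in> mball c (inverse (real (Suc k)))"
        using c by (simp add: centre_in_mball_iff)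
      with W have "c \<in> W"
        by blast
      from weak_star_nbhd[OF W(1) this] obtain J \<eta> where J: "finite J" "\<forall>x\<in>J. integrable lebesgue x"
          "0 < \<eta>" "\<forall>b\<in>Linf. (\<forall>x\<in>J. \<bar>pairing x b - pairing x c\<bar> < \<eta>) \<longrightarrow> b \<in> W"
        by blast
      have "f n \<in> mball c (inverse (real (Suc k)))" if "\<forall>x\<in>J. \<bar>pairing x (f n) - pairing x c\<bar> < \<eta>" for n
        using J(4) that f controls_subset_Linf[OF U(2)] W(2) by blast
      then have "d (f n) c < inverse (real (Suc k))"
        if "\<forall>x\<in>J. \<bar>pairing x (f n) - pairing x c\<bar> < \<eta>" for n
        using that by (simp add: commute)
      with cluster[of J \<eta>] J show ?thesis
        by (auto elim: frequently_elim1)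
    qed
    then have "\<exists>r. strict_mono r \<and> (\<forall>k. d (f (r k)) c < inverse (real (Suc k)))"
      by (rule strict_mono_choice)
    then obtain r where r: "strict_mono r" "\<And>k. d (f (r k)) c < inverse (real (Suc k))"
      by blast
    have "limitin mtopology (f \<circ> r) c sequentially"
      unfolding limitin_metric_dist_null
    proof (intro conjI)
      show "\<forall>\<^sub>F n in sequentially. (f \<circ> r) n \<in> controls U"
        using fc by simp
      show "(\<lambda>n. d ((f \<circ> r) n) c) \<longlonglongrightarrow> 0"
      proof (rule real_tendsto_sandwich[OF _ _ tendsto_const LIMSEQ_inverse_real_of_nat])
        show "\<forall>\<^sub>F n in sequentially. d ((f \<circ> r) n) c \<le> inverse (real (Suc n))"
          unfolding o_def by (intro always_eventually allI less_imp_le r(2))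
      qed simp
    qed fact
    with c r(1) show ?thesis
      by (intro exI conjI)
  qed
  then show ?thesis
    unfolding top[symmetric] compact_space_sequentially by (intro allI impI)
qed

text \<open>A continuous function on a compact metric space is uniformly continuous. This is how an
  estimate in an arbitrary compatible \<open>d\<close> becomes one on pairings.\<close>

lemma pairing_uniformly_continuous:
  fixes U :: "'a::euclidean_space set"
  assumes "compact U" "convex U" and "Metric_space (controls U) d"
    and top: "Metric_space.mtopology (controls U) d = control_topology U"
    and x: "integrable lebesgue x" and a: "\<And>n. a n \<in> controls U" and b: "\<And>n. b n \<in> controls U"
    and lim: "(\<lambda>n. d (a n) (b n)) \<longlonglongrightarrow> 0"
  shows "(\<lambda>n. pairing x (a n) - pairing x (b n)) \<longlonglongrightarrow> 0"
proof -
  interpret Metric_space "controls U" d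
    by fact
  have m: "mspace (metric (controls U, d)) = controls U" "mdist (metric (controls U, d)) = d"
    by (simp_all add: Metric_space_axioms)
  have "uniformly_continuous_map (metric (controls U, d)) euclidean_metric (pairing x)"
  proof (rule continuous_imp_uniformly_continuous_map, intro conjI)
    show "compact_space (mtopology_of (metric (controls U, d)))"
      using compact_space_controls[OF assms(1-4)] by (simp add: mtopology_of_def m top)
    show "continuous_map (mtopology_of (metric (controls U, d))) (mtopology_of euclidean_metric) (pairing x)"
      using continuous_map_from_subtopology[OF continuous_map_pairing[OF x]]
      by (simp add: mtopology_of_def m top control_topology_def)
  qed
  then have "(\<lambda>n. dist (pairing x (a n)) (pairing x (b n))) \<longlonglongrightarrow> 0"
    using a b lim unfolding uniformly_continuous_map_sequentially m by (auto simp: image_subset_iff)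
  then show ?thesis
    by (simp add: dist_real_def tendsto_rabs_zero_iff)
qed

section \<open>Gluing and shadowing\<close>

lemma integrable_shift:
  fixes x :: "real \<Rightarrow> 'a::euclidean_space"
  assumes "integrable lebesgue x"
  shows "integrable lebesgue (\<lambda>s. x (s - t))"
  using lebesgue_integrable_real_affine[OF assms, of 1 "- t"] by simp

lemma measurable_shift:
  fixes u :: "real \<Rightarrow> 'a::euclidean_space"
  assumes "u \<in> borel_measurable lebesgue"
  shows "(\<lambda>s. u (s + t)) \<in> borel_measurable lebesgue"
  using measurable_compose[OF shift_measurable_lebesgue assms] .

text \<open>Translation invariance of the integral moves the shift onto the test function.\<close>

lemma pairing_shift:
  assumes "c \<in> controls U" "integrable lebesgue x"
  shows "pairing x (shift t c) = pairing (\<lambda>s. x (s - t)) c"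
proof -
  obtain u where u: "u \<in> borel_measurable lebesgue" "AE t in lebesgue. u t \<in> U" "c = ae_rel `` {u}"
    using assms(1) by (rule controls_cases)
  have "(LINT s|lebesgue. x s \<bullet> u (s + t)) = (LINT s|lebesgue. x (s - t) \<bullet> u s)"
    using lebesgue_integral_real_affine[of 1 "\<lambda>s. x s \<bullet> u (s + t)" "- t"] by simp
  then show ?thesis
    using u assms(2) by (simp add: shift_class pairing_class measurable_shift integrable_shift)
qed

text \<open>Testing with the difference \<open>u - v\<close> cut off to one unit cell gives the
  integral of its squared norm there, so \<open>u = v\<close> almost everywhere on each of countably
  many cells. Tests inside single cells are the ones that gluing can evaluate.\<close>

lemma controls_eqI:
  fixes a b :: "(real \<Rightarrow> 'a::euclidean_space) set"
  assumes "bounded U" and a: "a \<in> controls U" and b: "b \<in> controls U"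
    and eq: "\<And>x k. integrable lebesgue x \<Longrightarrow> (\<And>t. \<lfloor>t\<rfloor> \<noteq> k \<Longrightarrow> x t = 0) \<Longrightarrow> pairing x a = pairing x b"
  shows "a = b"
proof -
  obtain C where C: "\<And>y. y \<in> U \<Longrightarrow> norm y \<le> C"
    using \<open>bounded U\<close> by (auto simp: bounded_iff)
  obtain u where u: "u \<in> borel_measurable lebesgue" "AE t in lebesgue. u t \<in> U" "a = ae_rel `` {u}"
    using a by (rule controls_cases)
  obtain v where v: "v \<in> borel_measurable lebesgue" "AE t in lebesgue. v t \<in> U" "b = ae_rel `` {v}"
    using b by (rule controls_cases)
  have uC: "AE t in lebesgue. norm (u t) \<le> C"
    using u(2) by eventually_elim (rule C)
  have vC: "AE t in lebesgue. norm (v t) \<le> C"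
    using v(2) by eventually_elim (rule C)
  have cell: "AE t in lebesgue. \<lfloor>t\<rfloor> = k \<longrightarrow> u t = v t" for k
  proof -
    define I where "I = {real_of_int k..<real_of_int k + 1}"
    have I: "t \<in> I \<longleftrightarrow> \<lfloor>t\<rfloor> = k" for t
      by (auto simp: I_def floor_eq_iff)
    define x where "x t = indicator I t *\<^sub>R (u t - v t)" for t
    have x: "integrable lebesgue x"
      unfolding x_def
    proof (rule integrableI_bounded_set_indicator)
      show "AE t in lebesgue. t \<in> I \<longrightarrow> norm (u t - v t) \<le> C + C"
        using uC vC by eventually_elim (metis add_mono norm_triangle_ineq4 order_trans)
    qed (use u(1) v(1) in \<open>simp_all add: I_def\<close>)
    have sq: "x t \<bullet> u t - x t \<bullet> v t = indicator I t * (norm (u t - v t))\<^sup>2" for t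
      by (simp add: x_def power2_norm_eq_inner inner_diff_right algebra_simps)
    have int: "integrable lebesgue (\<lambda>t. x t \<bullet> u t)" "integrable lebesgue (\<lambda>t. x t \<bullet> v t)"
      using integrable_inner_bounded[OF x u(1) uC] integrable_inner_bounded[OF x v(1) vC] .
    have "pairing x a = pairing x b"
      using x by (rule eq[where k = k]) (simp add: x_def I)
    then have "(LINT t|lebesgue. x t \<bullet> u t - x t \<bullet> v t) = 0"
      using int x u v by (simp add: pairing_class)
    then have "AE t in lebesgue. indicator I t * (norm (u t - v t))\<^sup>2 = 0"
      using integral_nonneg_eq_0_iff_AE[OF Bochner_Integration.integrable_diff[OF int]]
      unfolding sq by simp
    then show ?thesis
      by eventually_elim (simp add: indicator_def I)
  qed
  have "AE t in lebesgue. \<forall>k. \<lfloor>t\<rfloor> = k \<longrightarrow> u t = v t"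
    unfolding AE_all_countable using cell by blast
  then have "AE t in lebesgue. u t = v t"
    by eventually_elim simp
  then show ?thesis
    unfolding u(3) v(3) by (rule ae_rel_class_eqI[OF u(1) v(1)])
qed

definition representative :: "(real \<Rightarrow> 'a::euclidean_space) set \<Rightarrow> real \<Rightarrow> 'a"
  where "representative c = (SOME u. u \<in> borel_measurable lebesgue \<and> c = ae_rel `` {u})"

text \<open>The values of \<open>w i\<close> on \<open>[0, 1)\<close> are moved to
  \<open>[i, i + 1)\<close>. Working with chosen functions makes this a pointwise
  definition.\<close>

definition glue :: "(int \<Rightarrow> (real \<Rightarrow> 'a::euclidean_space) set) \<Rightarrow> real \<Rightarrow> 'a"
  where "glue w t = representative (w \<lfloor>t\<rfloor>) (t - of_int \<lfloor>t\<rfloor>)"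

text \<open>The chosen function inherits the constraint \<open>U\<close> from the function
  witnessing membership in \<open>controls U\<close>, since the two agree almost everywhere.\<close>

lemma representative:
  assumes "c \<in> controls U"
  shows "representative c \<in> borel_measurable lebesgue" and "c = ae_rel `` {representative c}"
    and "AE t in lebesgue. representative c t \<in> U"
proof -
  obtain u where u: "u \<in> borel_measurable lebesgue" "AE t in lebesgue. u t \<in> U" "c = ae_rel `` {u}"
    using assms by (rule controls_cases)
  then have "\<exists>u. u \<in> borel_measurable lebesgue \<and> c = ae_rel `` {u}"
    by (intro exI[of _ u] conjI)
  note r = someI_ex[OF this, folded representative_def]
  then show m: "representative c \<in> borel_measurable lebesgue" and c: "c = ae_rel `` {representative c}"
    by (rule conjunct1, rule conjunct2)
  have "representative c \<in> c"
    by (subst (2) c) (rule equiv_class_self[OF equiv_ae_rel m])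
  then have "representative c \<in> ae_rel `` {u}"
    using u(3) by simp
  then have "AE t in lebesgue. u t = representative c t"
    by (simp add: ae_rel_def)
  with u(2) show "AE t in lebesgue. representative c t \<in> U"
    by eventually_elim simp
qed

text \<open>The floor selects among countably many measurable pieces, and the exceptional null sets
  of these pieces have a null union.\<close>

lemma
  assumes w: "\<And>i. w i \<in> controls U"
  shows glue_measurable: "glue w \<in> borel_measurable lebesgue"
    and glue_in_controls: "ae_rel `` {glue w} \<in> controls U"
proof -
  have m: "(\<lambda>t. representative (w i) (t - of_int i)) \<in> borel_measurable lebesgue" for i
    using measurable_shift[OF representative(1)[OF w[of i]], of "- of_int i"] by simp
  show "glue w \<in> borel_measurable lebesgue"
    unfolding glue_def[abs_def]
    by (rule measurable_compose_countable[where f = "\<lambda>i t. representative (w i) (t - of_int i)", OF m])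
      (intro measurable_completion, simp)
  moreover have "AE t in lebesgue. glue w t \<in> U"
  proof -
    have "AE t in lebesgue. representative (w i) (t - of_int i) \<in> U" for i
      using AE_lebesgue_shift[OF representative(3)[OF w[of i]], of "- of_int i"] by simp
    then have "AE t in lebesgue. \<forall>i. representative (w i) (t - of_int i) \<in> U"
      by (simp add: AE_all_countable)
    then show ?thesis
      by eventually_elim (simp add: glue_def)
  qed
  ultimately show "ae_rel `` {glue w} \<in> controls U"
    by (rule controlsI)
qed

text \<open>Shifting by \<open>i\<close> moves cell \<open>k\<close> to cell \<open>i + k\<close>,
  where the glued function is the representative of \<open>w (i + k)\<close> read at
  \<open>t - k\<close>. Off cell \<open>k\<close> the test function vanishes, so nothing else
  contributes.\<close>

lemma pairing_shift_glue:
  assumes w: "\<And>i. w i \<in> controls U" and x: "integrable lebesgue x" and supp: "\<And>t. \<lfloor>t\<rfloor> \<noteq> k \<Longrightarrow> x t = 0"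
  shows "pairing x (shift (of_int i) (ae_rel `` {glue w})) = pairing x (shift (- of_int k) (w (i + k)))"
proof -
  note r = representative[OF w]
  have "shift (- of_int k) (w (i + k)) = ae_rel `` {\<lambda>t. representative (w (i + k)) (t + - of_int k)}"
    by (subst r(2)) (rule shift_class[OF r(1)])
  moreover have "x t \<bullet> glue w (t + of_int i) = x t \<bullet> representative (w (i + k)) (t + - of_int k)" for t
  proof (cases "\<lfloor>t\<rfloor> = k")
    case True
    then have "t + of_int i - of_int \<lfloor>t + of_int i\<rfloor> = t + - of_int k" "\<lfloor>t + of_int i\<rfloor> = i + k"
      by simp_all
    then show ?thesis
      by (simp add: glue_def add.commute)
  qed (simp add: supp)
  ultimately show ?thesis
    using x by (simp add: shift_class pairing_class glue_measurable[OF w] measurable_shift r(1)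
        measurable_shift[OF r(1), of _ "- of_int k", simplified])
qed

text \<open>Adding \<open>n\<close> preserves the fractional part and moves the index by
  \<open>n\<close>. Equal classes have equal representatives, so periodicity even holds at every
  point.\<close>

lemma glue_periodic:
  assumes w: "\<And>i. w i \<in> controls U" and per: "\<And>i. w (i + int n) = w i"
  shows "shift (real n) (ae_rel `` {glue w}) = ae_rel `` {glue w}"
proof -
  have "glue w (s + real n) = glue w s" for s
  proof -
    have "\<lfloor>s + real n\<rfloor> = \<lfloor>s\<rfloor> + int n"
      by linarith
    then show ?thesis
      by (simp add: glue_def per)
  qed
  then show ?thesis
    by (simp add: shift_class[OF glue_measurable[OF w]])
qed

text \<open>Induction on the number of jumps, for all test functions at once, because a jump is
  undone by translating \<open>x\<close>. The starting index \<open>j n\<close> may vary with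
  \<open>n\<close>, which yields uniformity along the pseudo-orbit.\<close>

lemma pseudo_orbit_pairing:
  fixes U :: "'a::euclidean_space set"
  assumes U: "compact U" "convex U" "Metric_space (controls U) d"
      "Metric_space.mtopology (controls U) d = control_topology U"
    and u: "\<And>n i. u n i \<in> controls U" and \<delta>: "\<delta> \<longlonglongrightarrow> 0"
    and step: "\<And>n i. d (shift 1 (u n i)) (u n (i + 1)) \<le> \<delta> n"
    and x: "integrable lebesgue x"
  shows "(\<lambda>n. pairing x (u n (j n + int m)) - pairing x (shift (real m) (u n (j n)))) \<longlonglongrightarrow> 0"
  using x
proof (induction m arbitrary: x)
  case 0
  then show ?case
    by (simp add: shift_zero)
next
  case (Suc m)
  interpret Metric_space "controls U" d
    by fact
  have "(\<lambda>n. pairing x (shift 1 (u n (j n + int m))) - pairing x (u n (j n + int m + 1))) \<longlonglongrightarrow> 0"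
  proof (rule pairing_uniformly_continuous[OF U Suc.prems])
    show "(\<lambda>n. d (shift 1 (u n (j n + int m))) (u n (j n + int m + 1))) \<longlonglongrightarrow> 0"
      by (rule real_tendsto_sandwich[OF _ _ tendsto_const \<delta>]) (simp_all add: step)
  qed (simp_all add: u shift_controls)
  \<comment> \<open>The induction hypothesis for the translated test function compares the two
    orbits after one more shift; the common term \<open>shift 1 (u n (j n + int m))\<close> cancels
    against the last jump.\<close>
  from tendsto_diff[OF Suc.IH[OF integrable_shift[OF Suc.prems, of 1]] this]
  have "(\<lambda>n. pairing x (u n (j n + int m + 1)) - pairing x (shift 1 (shift (real m) (u n (j n))))) \<longlonglongrightarrow> 0"
    by (simp add: pairing_shift[OF u Suc.prems] pairing_shift[OF shift_controls[OF u] Suc.prems])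
  then show ?case
    by (simp add: shift_add algebra_simps)
qed

lemma (in Metric_space) compact_space_subsequence:
  fixes f :: "nat \<Rightarrow> 'a"
  assumes "compact_space mtopology" "\<And>n. f n \<in> M"
  shows "\<exists>l r. l \<in> M \<and> strict_mono r \<and> limitin mtopology (f \<circ> r) l sequentially"
  by (rule assms(1)[unfolded compact_space_sequentially, rule_format]) (use assms(2) in auto)

text \<open>By contradiction and compactness: if no \<open>\<delta>\<close> works, pseudo-orbits
  with jumps tending to zero violate the bound at some indices, yet both sides have a common limit
  along a subsequence. Naming the glued control makes it the same for all \<open>i\<close>.\<close>

lemma shadowing:
  fixes U :: "'a::euclidean_space set"
  assumes U: "compact U" "convex U" "Metric_space (controls U) d"
      "Metric_space.mtopology (controls U) d = control_topology U"
    and "0 < \<epsilon>"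
  shows "\<exists>\<delta>>0. \<forall>u i. (\<forall>i. u i \<in> controls U) \<and> (\<forall>i. d (shift 1 (u i)) (u (i + 1)) \<le> \<delta>) \<longrightarrow>
           d (shift (of_int i) (ae_rel `` {glue u})) (u i) \<le> \<epsilon>"
proof (rule ccontr)
  assume contra: "\<not> ?thesis"
  interpret Metric_space "controls U" d
    by fact
  define \<delta> where "\<delta> n = inverse (real (Suc n))" for n
  have "\<exists>u i. (\<forall>i. u i \<in> controls U) \<and> (\<forall>i. d (shift 1 (u i)) (u (i + 1)) \<le> \<delta> n) \<and>
      \<epsilon> < d (shift (of_int i) (ae_rel `` {glue u})) (u i)" for n
  proof -
    have "0 < \<delta> n"
      by (simp add: \<delta>_def)
    with contra show ?thesis
      by (meson not_le)
  qed
  then obtain u i where u: "\<And>n k. u n k \<in> controls U"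
      and step: "\<And>n k. d (shift 1 (u n k)) (u n (k + 1)) \<le> \<delta> n"
      and far: "\<And>n. \<epsilon> < d (shift (of_int (i n)) (ae_rel `` {glue (u n)})) (u n (i n))"
    by metis
  define a where "a n = shift (of_int (i n)) (ae_rel `` {glue (u n)})" for n
  define b where "b n = u n (i n)" for n
  have aU: "a n \<in> controls U" and bU: "b n \<in> controls U" for n
    by (simp_all add: a_def b_def u shift_controls glue_in_controls)
  have compact: "compact_space mtopology"
    using compact_space_controls[OF U] U(4) by simp
  obtain a' r where a': "a' \<in> controls U" "strict_mono r" "limitin mtopology (a \<circ> r) a' sequentially"
    using compact_space_subsequence[OF compact, of a] aU by blast
  \<comment> \<open>The second subsequence is taken along the first, so that \<open>q\<close> serves
    both.\<close>
  obtain b' s where b': "b' \<in> controls U" "strict_mono s" "limitin mtopology (b \<circ> r \<circ> s) b' sequentially"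
    using compact_space_subsequence[OF compact, of "b \<circ> r"] bU by auto
  define q where "q = r \<circ> s"
  have q: "strict_mono q"
    unfolding q_def using a'(2) b'(2) by (rule strict_mono_o)
  have la: "limitin mtopology (a \<circ> q) a' sequentially" and lb: "limitin mtopology (b \<circ> q) b' sequentially"
    using limitin_subsequence[OF b'(2) a'(3)] b'(3) by (simp_all add: q_def o_assoc)
  have "a' = b'"
  proof (rule controls_eqI[OF compact_imp_bounded[OF \<open>compact U\<close>] a'(1) b'(1)])
    fix x :: "real \<Rightarrow> 'a" and k
    assume x: "integrable lebesgue x" and supp: "\<And>t. \<lfloor>t\<rfloor> \<noteq> k \<Longrightarrow> x t = 0"
    have pa: "pairing x (a n) = pairing x (shift (- of_int k) (u n (i n + k)))" for n
      unfolding a_def by (rule pairing_shift_glue[where w = "u n", OF u x supp])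
    have "\<delta> \<longlonglongrightarrow> 0"
      unfolding \<delta>_def by (rule LIMSEQ_inverse_real_of_nat)
    note orbit = pseudo_orbit_pairing[where u = u and \<delta> = \<delta>, OF U u this step]
    have "(\<lambda>n. pairing x (a n) - pairing x (b n)) \<longlonglongrightarrow> 0"
    \<comment> \<open>For \<open>k \<ge> 0\<close> the orbit runs \<open>k\<close> steps from
      \<open>u n (i n)\<close> and is shifted back by translating the test function. For
      \<open>k < 0\<close> it runs \<open>- k\<close> steps from \<open>u n (i n + k)\<close> up to
      \<open>u n (i n)\<close>, which exchanges the two sides and produces the minus sign.\<close>
    proof (cases "0 \<le> k")
      case True
      define y where "y = (\<lambda>s. x (s - - of_int k))"
      have "integrable lebesgue y"
        unfolding y_def using x by (rule integrable_shift)
      then have "(\<lambda>n. pairing y (u n (i n + int (nat k))) - pairing y (shift (real (nat k)) (u n (i n)))) \<longlonglongrightarrow> 0"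
        by (rule orbit)
      moreover have "pairing y c = pairing x (shift (- of_int k) c)" if "c \<in> controls U" for c
        unfolding y_def using that x by (rule pairing_shift[symmetric])
      ultimately show ?thesis
        using True by (simp add: pa b_def u shift_controls shift_add shift_zero)
    next
      case False
      have "(\<lambda>n. pairing x (u n (i n + k + int (nat (- k))))
          - pairing x (shift (real (nat (- k))) (u n (i n + k)))) \<longlonglongrightarrow> 0"
        using x by (rule orbit)
      then have "(\<lambda>n. - (pairing x (a n) - pairing x (b n))) \<longlonglongrightarrow> 0"
        using False by (simp add: pa b_def)
      from tendsto_minus[OF this] show ?thesis
        by simp
    qed
    then have 0: "(\<lambda>n. pairing x (a (q n)) - pairing x (b (q n))) \<longlonglongrightarrow> 0"
      using LIMSEQ_subseq_LIMSEQ[OF _ q] by (fastforce simp: o_def)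
    have cont: "continuous_map mtopology euclideanreal (pairing x)"
      unfolding U(4) control_topology_def
      by (rule continuous_map_from_subtopology[OF continuous_map_pairing[OF x]])
    have "(\<lambda>n. pairing x (a (q n))) \<longlonglongrightarrow> pairing x a'" "(\<lambda>n. pairing x (b (q n))) \<longlonglongrightarrow> pairing x b'"
      using continuous_map_limit[OF cont la] continuous_map_limit[OF cont lb] by (simp_all add: o_def)
    from LIMSEQ_unique[OF 0 tendsto_diff[OF this]] show "pairing x a' = pairing x b'"
      by simp
  qed
  \<comment> \<open>The common limit brings both sequences within \<open>\<epsilon>\<close> of each
    other, contrary to \<open>far\<close>.\<close>
  have "(\<lambda>n. d (a (q n)) a' + d (b (q n)) a') \<longlonglongrightarrow> 0 + 0"
    using la lb unfolding \<open>a' = b'\<close> limitin_metric_dist_null by (intro tendsto_add) (simp_all add: o_def)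
  then have "\<forall>\<^sub>F n in sequentially. d (a (q n)) a' + d (b (q n)) a' < \<epsilon>"
    using \<open>0 < \<epsilon>\<close> by (intro order_tendstoD) simp_all
  then obtain n where "d (a (q n)) a' + d (b (q n)) a' < \<epsilon>"
    by (auto simp: eventually_sequentially)
  moreover have "d (a (q n)) (b (q n)) \<le> d (a (q n)) a' + d (b (q n)) a'"
    using triangle[OF aU a'(1) bU, of "q n" "q n"] by (simp add: commute)
  ultimately show False
    using far[of "q n"] by (simp add: a_def b_def)
qed

theorem corollary5p2:
  fixes U :: "(real ^ 'm) set"
    and d :: "(real \<Rightarrow> real ^ 'm) set \<Rightarrow> (real \<Rightarrow> real ^ 'm) set \<Rightarrow> real"
  assumes "compact U" and "convex U"
    and "Metric_space (controls U) d"
    and "Metric_space.mtopology (controls U) d = control_topology U"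
  shows "\<forall>\<epsilon>>0. \<exists>\<delta>>0. \<forall>u :: int \<Rightarrow> (real \<Rightarrow> real ^ 'm) set.
           (\<forall>i. u i \<in> controls U) \<and> (\<forall>i. d (shift 1 (u i)) (u (i + 1)) \<le> \<delta>) \<longrightarrow>
           (\<exists>v \<in> controls U.
              (\<forall>i. d (shift (real_of_int i) v) (u i) \<le> \<epsilon>) \<and>
              (\<forall>n::nat. n \<ge> 1 \<and> (\<forall>i. u (i + int n) = u i) \<longrightarrow> shift (real n) v = v))"
proof (intro allI impI)
  fix \<epsilon> :: real
  assume "0 < \<epsilon>"
  from shadowing[OF assms this] obtain \<delta> where "0 < \<delta>" and \<delta>: "\<And>u i. (\<forall>i. u i \<in> controls U) \<Longrightarrow>
      (\<forall>i. d (shift 1 (u i)) (u (i + 1)) \<le> \<delta>) \<Longrightarrow> d (shift (of_int i) (ae_rel `` {glue u})) (u i) \<le> \<epsilon>"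
    by blast
  show "\<exists>\<delta>>0. \<forall>u. (\<forall>i. u i \<in> controls U) \<and> (\<forall>i. d (shift 1 (u i)) (u (i + 1)) \<le> \<delta>) \<longrightarrow>
           (\<exists>v \<in> controls U. (\<forall>i. d (shift (real_of_int i) v) (u i) \<le> \<epsilon>) \<and>
              (\<forall>n::nat. n \<ge> 1 \<and> (\<forall>i. u (i + int n) = u i) \<longrightarrow> shift (real n) v = v))"
  proof (rule exI[of _ \<delta>], intro conjI allI impI)
    show "0 < \<delta>"
      by fact
  next
    fix u :: "int \<Rightarrow> (real \<Rightarrow> real ^ 'm) set"
    assume "(\<forall>i. u i \<in> controls U) \<and> (\<forall>i. d (shift 1 (u i)) (u (i + 1)) \<le> \<delta>)"
    \<comment> \<open>One glued control serves every index \<open>i\<close> and every period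
      \<open>n\<close> at once.\<close>
    then show "\<exists>v \<in> controls U. (\<forall>i. d (shift (real_of_int i) v) (u i) \<le> \<epsilon>) \<and>
        (\<forall>n::nat. n \<ge> 1 \<and> (\<forall>i. u (i + int n) = u i) \<longrightarrow> shift (real n) v = v)"
      by (intro bexI[of _ "ae_rel `` {glue u}"] conjI allI impI)
        (simp_all add: \<delta> glue_in_controls glue_periodic[where U = U])
  qed
qed

end
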